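(* Let $P=(h_0,h_1,u_0,u_1,l_0,l_1)\in\{M,V\}^6$, define the physical projection $\pi_1(P)=(h_0,h_1,u_0,l_0)$, and with $M=+1$, $V=-1$ put $\delta_0(P)=h_0h_1u_0l_0$. Then words with the same $\pi_1(P)$ define the same assigned map and the same labelled state set $F(P,1)$. Moreover, $$\delta_0(P)=+1\Longrightarrow F(P,1)=\varnothing,\qquad \delta_0(P)=-1\Longrightarrow F(P,1)=\{\Omega(\pi_1(P))\}$$ for one exact labelled total order $\Omega(\pi_1(P))$ of the four faces (depending only on $\pi_1(P)$).
   Context: The case $k=1$: the map is $2\times2$ with upper faces $A_1,A_2$ and lower faces $B_1,B_2$. Its only creases are $H_1=(A_1,B_1)$, $H_2=(A_2,B_2)$, $U_1=(A_1,A_2)$, $L_1=(B_1,B_2)$, labelled $h_0,h_1,u_0,l_0$ respectively; the letters $u_1,l_1$ of $P$ label no crease. The two faces of a crease are its wings. The assignment is locally flat-foldable if an odd number of the four creases (all meeting at the single interior vertex) are labelled $M$. $x\prec y$ means $x$ comes before (above) $y$. A strict total order of the four labelled faces is order-valid for $P$ if: (i) Precedence: with $A_c$ in row $r=0$ and $B_c$ in row $r=1$, the face in row $r$, column $c$ is light-up iff $r+c-1$ is even and dark-up otherwise; across each $M$ crease the light-up wing precedes the dark-up wing, across each $V$ crease the dark-up wing precedes the light-up wing. (ii) Noncrossing: for each of the two pairs of creases $(H_1,H_2)$ and $(U_1,L_1)$, with wing positions $a_0<a_1$ and $b_0<b_1$ in the order, neither $a_0<b_0<a_1<b_1$ nor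 $b_0<a_0<b_1<a_1$. $F(P,1)$ is the set of all order-valid strict total orders if the assignment is locally flat-foldable, and $F(P,1)=\varnothing$ otherwise. *)

theory Defs
  imports Main
begin

datatype mv = M | V

datatype face = A1 | A2 | B1 | B2

datatype crease = H1 | H2 | U1 | L1

datatype word = Word (h0: mv) (h1: mv) (u0: mv) (u1: mv) (l0: mv) (l1: mv)

fun mv_sign :: "mv \<Rightarrow> int" where
  "mv_sign M = 1"
| "mv_sign V = -1"

definition proj1 :: "word \<Rightarrow> mv \<times> mv \<times> mv \<times> mv" where
  "proj1 P = (h0 P, h1 P, u0 P, l0 P)"

definition delta0 :: "word \<Rightarrow> int" where
  "delta0 P = mv_sign (h0 P) * mv_sign (h1 P) * mv_sign (u0 P) * mv_sign (l0 P)"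

fun wings :: "crease \<Rightarrow> face set" where
  "wings H1 = {A1, B1}"
| "wings H2 = {A2, B2}"
| "wings U1 = {A1, A2}"
| "wings L1 = {B1, B2}"

text \<open>The underlying crease pattern (faces, creases and wings) is the same for all words, so an
  assigned map is given by the labels of its four creases.\<close>

type_synonym assigned_map = "crease \<Rightarrow> mv"

fun assigned_map :: "word \<Rightarrow> assigned_map" where
  "assigned_map P H1 = h0 P"
| "assigned_map P H2 = h1 P"
| "assigned_map P U1 = u0 P"
| "assigned_map P L1 = l0 P"

fun row :: "face \<Rightarrow> int" where
  "row A1 = 0"
| "row A2 = 0"
| "row B1 = 1"
| "row B2 = 1"

fun column :: "face \<Rightarrow> int" where
  "column A1 = 1"
| "column A2 = 2"
| "column B1 = 1"
| "column B2 = 2"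

definition light_up :: "face \<Rightarrow> bool" where
  "light_up f \<longleftrightarrow> even (row f + column f - 1)"

abbreviation dark_up :: "face \<Rightarrow> bool" where
  "dark_up f \<equiv> \<not> light_up f"

text \<open>All four creases meet at the single interior vertex.\<close>

definition locally_flat_foldable :: "word \<Rightarrow> bool" where
  "locally_flat_foldable P \<longleftrightarrow> odd (card {c. assigned_map P c = M})"

text \<open>A layer order is a relation \<open>r\<close> on faces; \<open>(x, y) \<in> r\<close> means that \<open>x\<close> comes before (above)
  \<open>y\<close>.\<close>

type_synonym layer_order = "(face \<times> face) set"

definition precedence :: "word \<Rightarrow> layer_order \<Rightarrow> bool" where
  "precedence P r \<longleftrightarrow>
     (\<forall>c. \<forall>x \<in> wings c. \<forall>y \<in> wings c. light_up x \<and> dark_up y \<longrightarrow>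
        (case assigned_map P c of M \<Rightarrow> (x, y) \<in> r | V \<Rightarrow> (y, x) \<in> r))"

text \<open>In a strict total order the wing positions \<open>a\<^sub>0 < a\<^sub>1\<close> and \<open>b\<^sub>0 < b\<^sub>1\<close> of two creases are
  compared through the faces occupying them.\<close>

definition noncrossing_pair :: "layer_order \<Rightarrow> crease \<Rightarrow> crease \<Rightarrow> bool" where
  "noncrossing_pair r c d \<longleftrightarrow>
     (\<forall>a\<^sub>0 a\<^sub>1 b\<^sub>0 b\<^sub>1. wings c = {a\<^sub>0, a\<^sub>1} \<and> (a\<^sub>0, a\<^sub>1) \<in> r \<and> wings d = {b\<^sub>0, b\<^sub>1} \<and> (b\<^sub>0, b\<^sub>1) \<in> r \<longrightarrow>
        \<not> ((a\<^sub>0, b\<^sub>0) \<in> r \<and> (b\<^sub>0, a\<^sub>1) \<in> r \<and> (a\<^sub>1, b\<^sub>1) \<in> r) \<and>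
        \<not> ((b\<^sub>0, a\<^sub>0) \<in> r \<and> (a\<^sub>0, b\<^sub>1) \<in> r \<and> (b\<^sub>1, a\<^sub>1) \<in> r))"

definition noncrossing :: "layer_order \<Rightarrow> bool" where
  "noncrossing r \<longleftrightarrow> noncrossing_pair r H1 H2 \<and> noncrossing_pair r U1 L1"

definition order_valid :: "word \<Rightarrow> layer_order \<Rightarrow> bool" where
  "order_valid P r \<longleftrightarrow> strict_linear_order r \<and> precedence P r \<and> noncrossing r"

text \<open>The labelled state set \<open>F(P, 1)\<close>.\<close>

definition F1 :: "word \<Rightarrow> layer_order set" where
  "F1 P = (if locally_flat_foldable P then {r. order_valid P r} else {})"

end

theory Submission
  imports Defs
begin

text \<open>The four creases form a 4-cycle on the faces, and the assignment orients its edges. Going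
  once around, the light-up and dark-up faces alternate, so an odd number of \<open>M\<close> labels means that
  an odd number of the edges point forward: three point one way and one the other. The three agreeing
  edges form a Hamiltonian path, which is the only linear order compatible with the orientation;
  opposite edges of the cycle are then nested or disjoint in it, so noncrossing is automatic.\<close>

lemma UNIV_face: "(UNIV :: face set) = {A1, A2, B1, B2}"
  using face.exhaust by auto

lemma UNIV_face_distinct:
  assumes "distinct [a, b, c, d :: face]"
  shows "UNIV = {a, b, c, d}"
proof -
  have "{a, b, c, d} = UNIV"
  proof (rule card_subset_eq)
    show "finite (UNIV :: face set)"
      by (simp add: UNIV_face)
    show "card {a, b, c, d} = card (UNIV :: face set)"
      using assms by (simp add: UNIV_face)
  qed simp
  then show ?thesis ..
qed

lemma UNIV_crease: "(UNIV :: crease set) = {H1, H2, U1, L1}"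
  using crease.exhaust by auto

lemma all_crease: "(\<forall>c. Q c) \<longleftrightarrow> Q H1 \<and> Q H2 \<and> Q U1 \<and> Q L1"
  by (metis crease.exhaust)

lemma assigned_map_cong:
  assumes "proj1 P = proj1 Q"
  shows "assigned_map P = assigned_map Q"
proof
  show "assigned_map P c = assigned_map Q c" for c
    using assms by (cases c) (simp_all add: proj1_def)
qed

text \<open>Both foldability and precedence consult the word only through its crease labels.\<close>

lemma F1_cong: "assigned_map P = assigned_map Q \<Longrightarrow> F1 P = F1 Q"
  unfolding F1_def locally_flat_foldable_def order_valid_def precedence_def by simp

lemma card_creases:
  "card {c. Q c} = of_bool (Q H1) + of_bool (Q H2) + of_bool (Q U1) + of_bool (Q L1)"
proof -
  have "finite (UNIV :: crease set)"
    by (simp add: UNIV_crease)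
  from sum.inter_filter[OF this, of "\<lambda>_. 1 :: nat" Q]
  have "card {c. Q c} = (\<Sum>c\<in>UNIV. of_bool (Q c))"
    by (simp add: of_bool_def)
  then show ?thesis
    by (simp add: UNIV_crease)
qed

text \<open>The sign product is -1 to the number of \<open>V\<close> labels; with four creases this
  number has the same parity as the number of \<open>M\<close> labels.\<close>

lemma locally_flat_foldable_iff_delta0: "locally_flat_foldable P \<longleftrightarrow> delta0 P = -1"
  unfolding locally_flat_foldable_def card_creases delta0_def
  by (cases "h0 P"; cases "h1 P"; cases "u0 P"; cases "l0 P") simp_all

text \<open>The light-up faces are \<open>A1\<close> and \<open>B2\<close>, so an \<open>M\<close>
  label on \<open>H2\<close> or \<open>L1\<close> puts the \<open>B2\<close> wing first.\<close>

lemma precedence_iff: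
  "precedence P r \<longleftrightarrow>
     (if h0 P = M then (A1, B1) \<in> r else (B1, A1) \<in> r) \<and>
     (if h1 P = M then (B2, A2) \<in> r else (A2, B2) \<in> r) \<and>
     (if u0 P = M then (A1, A2) \<in> r else (A2, A1) \<in> r) \<and>
     (if l0 P = M then (B2, B1) \<in> r else (B1, B2) \<in> r)"
  by (auto simp: precedence_def all_crease light_up_def split: mv.splits)

definition chain :: "'a \<Rightarrow> 'a \<Rightarrow> 'a \<Rightarrow> 'a \<Rightarrow> ('a \<times> 'a) set" where
  "chain a b c d = {(a, b), (a, c), (a, d), (b, c), (b, d), (c, d)}"

lemma strict_linear_order_chain:
  assumes "distinct [a, b, c, d]" and "UNIV = {a, b, c, d}"
  shows "strict_linear_order (chain a b c d)"
proof -
  have "total_on {a, b, c, d} (chain a b c d)"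
    by (simp add: total_on_def chain_def)
  then have "total (chain a b c d)"
    by (simp add: assms(2))
  moreover have "trans (chain a b c d)" "irrefl (chain a b c d)"
    using assms(1) by (auto simp: chain_def trans_def irrefl_def)
  ultimately show ?thesis
    by (simp add: strict_linear_order_on_def)
qed

text \<open>In a chain of four, only the 1st and 3rd against the 2nd and 4th elements can cross.\<close>

lemma noncrossing_pair_chain:
  assumes "distinct [w, x, y, z]" and "wings e \<noteq> {w, y}" and "wings e \<noteq> {x, z}"
  shows "noncrossing_pair (chain w x y z) e f"
proof -
  \<comment> \<open>Three successive ascents in a chain of four must visit all its elements in
    order.\<close>
  have crossing: "a = w \<and> b = x \<and> a' = y \<and> b' = z"
    if "(a, b) \<in> chain w x y z" "(b, a') \<in> chain w x y z" "(a', b') \<in> chain w x y z"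
    for a b a' b'
    using that assms(1) by (auto simp: chain_def)
  show ?thesis
    unfolding noncrossing_pair_def
  proof (intro allI impI conjI notI; elim conjE)
    fix a a' b b'
    assume "wings e = {a, a'}" "(a, b) \<in> chain w x y z" "(b, a') \<in> chain w x y z"
      "(a', b') \<in> chain w x y z"
    then show False
      using crossing[of a b a' b'] assms(2) by simp
  next
    fix a a' b b'
    assume "wings e = {a, a'}" "(b, a) \<in> chain w x y z" "(a, b') \<in> chain w x y z"
      "(b', a') \<in> chain w x y z"
    then show False
      using crossing[of b a b' a'] assms(3) by simp
  qed
qed

text \<open>A pair of \<open>r\<close> missing from \<open>s\<close> would, by totality, be reversed
  in \<open>s\<close> and hence in \<open>r\<close>, against asymmetry.\<close>

lemma strict_linear_order_eq:
  assumes "strict_linear_order r" and "strict_linear_order s" and "s \<subseteq> r"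
  shows "r = s"
proof
  show "r \<subseteq> s"
  proof
    fix p assume "p \<in> r"
    moreover obtain x y where p: "p = (x, y)"
      by fastforce
    ultimately have "x \<noteq> y" and "(y, x) \<notin> r"
      using assms(1) by (auto simp: strict_linear_order_on_def irrefl_def trans_def)
    then show "p \<in> s"
      using assms(2,3) p by (auto simp: strict_linear_order_on_def total_on_def)
  qed
qed (fact assms(3))

lemma strict_linear_order_eq_chain:
  assumes "strict_linear_order r" and "distinct [a, b, c, d]" and "UNIV = {a, b, c, d}"
    and "(a, b) \<in> r" and "(b, c) \<in> r" and "(c, d) \<in> r"
  shows "r = chain a b c d"
proof (rule strict_linear_order_eq)
  have "trans r"
    using assms(1) by (simp add: strict_linear_order_on_def)
  then show "chain a b c d \<subseteq> r"
    using assms(4-6) by (auto simp: chain_def dest: transD)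
qed (use assms(1) strict_linear_order_chain[OF assms(2,3)] in simp_all)

text \<open>The assignments with an even number of \<open>M\<close> labels are irrelevant and get a junk value.\<close>

fun face_order :: "mv \<times> mv \<times> mv \<times> mv \<Rightarrow> layer_order" where
  "face_order (M, V, V, V) = chain A2 A1 B1 B2"
| "face_order (V, M, V, V) = chain B1 B2 A2 A1"
| "face_order (V, V, M, V) = chain B1 A1 A2 B2"
| "face_order (V, V, V, M) = chain A2 B2 B1 A1"
| "face_order (V, M, M, M) = chain B2 B1 A1 A2"
| "face_order (M, V, M, M) = chain A1 A2 B2 B1"
| "face_order (M, M, V, M) = chain B2 A2 A1 B1"
| "face_order (M, M, M, V) = chain A1 B1 B2 A2"
| "face_order _ = {}"

text \<open>A negative product means that exactly one of the four labels differs from the other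
  three.\<close>

lemma odd_assignment_cases:
  assumes "delta0 P = -1"
  shows "proj1 P \<in> {(M, V, V, V), (V, M, V, V), (V, V, M, V), (V, V, V, M),
    (V, M, M, M), (M, V, M, M), (M, M, V, M), (M, M, M, V)}"
  using assms unfolding delta0_def proj1_def
  by (cases "h0 P"; cases "h1 P"; cases "u0 P"; cases "l0 P") simp_all

lemma strict_linear_order_face_order:
  assumes "delta0 P = -1"
  shows "strict_linear_order (face_order (proj1 P))"
  using odd_assignment_cases[OF assms]
  by (elim insertE emptyE)
    (simp_all add: strict_linear_order_chain UNIV_face_distinct)

text \<open>In each of the eight chains, the 1st and 3rd faces are diagonally opposite, as are the
  2nd and 4th, so neither pair is the wing set of a crease.\<close>

lemma noncrossing_face_order:
  assumes "delta0 P = -1"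
  shows "noncrossing (face_order (proj1 P))"
  using odd_assignment_cases[OF assms] unfolding noncrossing_def
  by (elim insertE emptyE)
    (simp_all add: noncrossing_pair_chain doubleton_eq_iff)

lemma precedence_face_order:
  assumes "delta0 P = -1"
  shows "precedence P (face_order (proj1 P))"
  using odd_assignment_cases[OF assms]
  by (auto simp: precedence_iff chain_def proj1_def)

text \<open>In each case three of the precedence conditions relate successive faces of the listed
  chain, which pins down \<open>r\<close>; the fourth relates its first face to its last.\<close>

lemma precedence_imp_eq_face_order:
  assumes "delta0 P = -1" and "strict_linear_order r" and "precedence P r"
  shows "r = face_order (proj1 P)"
  using odd_assignment_cases[OF assms(1)] assms(3) unfolding precedence_iff
  by (elim insertE emptyE)
    (simp_all add: proj1_def strict_linear_order_eq_chain[OF assms(2)] UNIV_face_distinct)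

lemma F1_eq_face_order:
  assumes "delta0 P = -1"
  shows "F1 P = {face_order (proj1 P)}"
proof -
  have "order_valid P r \<longleftrightarrow> r = face_order (proj1 P)" for r
    using assms precedence_imp_eq_face_order strict_linear_order_face_order
      precedence_face_order noncrossing_face_order
    unfolding order_valid_def by blast
  then show ?thesis
    unfolding F1_def locally_flat_foldable_iff_delta0 using assms by auto
qed

theorem proposition9p1:
  shows "(\<forall>P Q :: word. proj1 P = proj1 Q \<longrightarrow> assigned_map P = assigned_map Q \<and> F1 P = F1 Q) \<and>
    (\<exists>\<Omega> :: mv \<times> mv \<times> mv \<times> mv \<Rightarrow> layer_order. \<forall>P :: word.
       (delta0 P = 1 \<longrightarrow> F1 P = {}) \<and>
       (delta0 P = -1 \<longrightarrow> strict_linear_order (\<Omega> (proj1 P)) \<and> F1 P = {\<Omega> (proj1 P)}))"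
proof (intro conjI exI[of _ face_order] allI impI)
  fix P Q :: word
  assume "proj1 P = proj1 Q"
  then show "assigned_map P = assigned_map Q"
    by (rule assigned_map_cong)
  then show "F1 P = F1 Q"
    by (rule F1_cong)
next
  fix P :: word
  assume "delta0 P = 1"
  then show "F1 P = {}"
    by (simp add: F1_def locally_flat_foldable_iff_delta0)
qed (simp_all add: strict_linear_order_face_order F1_eq_face_order)

end
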